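(* Let $(\mathfrak g,Q,f)$ be a unimodular $L_\infty$-algebra. Pairs $(V,g)$, with $V$ a vector field and $g$ a function on $\mathfrak g[1]$, such that $(\mathfrak g,Q+V,f+g)$ is again a unimodular $L_\infty$-algebra are in one-to-one correspondence with Maurer-Cartan elements in the deformation complex $C(\mathfrak g,Q,f)$.
   Context: $\mathbb k$ is a field of characteristic zero; $\mathfrak g$ is a finite dimensional graded vector space; $\mathfrak g[1]^i=\mathfrak g^{i+1}$; differentials have degree $+1$. Formal geometry. $\mathcal O_{\mathfrak g[1]}=\prod_{n\ge0}\odot^n\mathfrak g[1]^*$ is the ring of functions on the formal pointed graded manifold $(\mathfrak g[1],0)$; the ideal of $0$ is $\prod_{n\ge1}\odot^n\mathfrak g[1]^*$. $\mathcal T_{\mathfrak g[1]}=\mathrm{Der}\,\mathcal O_{\mathfrak g[1]}$ is the space of vector fields, a graded Lie algebra under the graded commutator. A basis of $\mathfrak g$ gives linear coordinates $x^\alpha$ on $\mathfrak g[1]$ with $\mathcal O_{\mathfrak g[1]}\cong\mathbb k[[x^\alpha]]$ and $\mathcal T_{\mathfrak g[1]}$ free on $\partial_\alpha=\partial/\partial x^\alpha$. For $V=V^\alpha\partial_\alpha$ the divergence with respect to the constant volume form $\Delta_x$ is $\mathrm{div}\,V=\sum_\alpha(-1)^{|x^\alpha||V^\alpha|}\partial_\alpha V^\alpha$. For a degree zero function $f$, $\mathrm{div}_fV=\mathrm{div}\,V+V(f)$, which is the divergence with respect to the volume form $\rho_f=e^f\Delta_x$. Unimodular $L_\infty$-algebras.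 An $L_\infty$-structure on $\mathfrak g$ (its differential included) is given by a vector field $Q$ of degree $1$ with $Q^2=0$ and $Q|_0=0$. A unimodular $L_\infty$-algebra $(\mathfrak g,Q,f)$ is given by such a $Q$ together with a degree zero function $f$ in the ideal of $0$ such that $\mathrm{div}_fQ=\mathrm{div}\,Q+Q(f)=0$, i.e. such that $\rho_f$ is $Q$-invariant. Deformation complex. $C(\mathfrak g,Q,f)=\mathrm{cone}(\mathrm{div}_f)[-1]$, where $\mathrm{div}_f:(\mathcal T_{\mathfrak g[1]},[Q,-])\to(\mathcal O_{\mathfrak g[1]},Q)$ is a morphism of dg vector spaces; that is, $C(\mathfrak g,Q,f)=\mathcal T_{\mathfrak g[1]}\oplus\mathcal O_{\mathfrak g[1]}[-1]$ with differential $\partial(V+sg)=[Q,V]-sQ(g)+s\,\mathrm{div}_fV$, where $s$ denotes the degree $1$ identification $\mathcal O_{\mathfrak g[1]}\to\mathcal O_{\mathfrak g[1]}[-1]$. The bracket extends the commutator on $\mathcal T_{\mathfrak g[1]}$ by $[V,sg]=(-1)^{|V|}sV(g)$ and $[sg_1,sg_2]=0$. With this, $C(\mathfrak g,Q,f)$ is a dg Lie algebra. A Maurer-Cartan element is a degree $1$ element $m$ with $\partial m+\tfrac12[m,m]=0$.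
   Formalization: As stated it fails for 𝔤=0 (one pair, but all of 𝕜 is Maurer-Cartan); proved instead: pairs match Maurer-Cartan elements whose V and function vanish at 0, and all Maurer-Cartan elements match pairs with the conditions at 0 dropped for (Q+V,f+g). *)

theory Defs
  imports Complex_Main "HOL-Library.Function_Algebras" "HOL-Library.Product_Plus"
begin

section \<open>Graded vector spaces and linear coordinates on the shift\<close>

locale graded_vector_space = vector_space scale
  for scale :: "'k::field_char_0 \<Rightarrow> 'v::ab_group_add \<Rightarrow> 'v" +
  fixes gr :: "int \<Rightarrow> 'v set"
  assumes subspace_gr: "subspace (gr n)"
    and direct_sum: "\<exists>!u. (\<forall>n. u n \<in> gr n) \<and> finite {n. u n \<noteq> 0} \<and> v = (\<Sum>n | u n \<noteq> 0. u n)"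
    and finite_dim: "\<exists>B. finite B \<and> span B = UNIV"

definition shift :: "(int \<Rightarrow> 'v set) \<Rightarrow> int \<Rightarrow> int \<Rightarrow> 'v set" where
  "shift gr k n = gr (n + k)"

text \<open>
  The list \<open>es\<close> is a homogeneous basis of \<open>\<gg>\<close>, and \<open>d ! \<alpha>\<close> is the degree of the coordinate
  \<open>x\<^sup>\<alpha>\<close> on \<open>\<gg>[1]\<close> dual to \<open>es ! \<alpha>\<close>. Dualising negates degrees, so \<open>es ! \<alpha>\<close> has degree
  \<open>- d ! \<alpha>\<close> in \<open>\<gg>[1]\<close>.
\<close>

locale homogeneous_coordinates = graded_vector_space scale gr
  for scale :: "'k::field_char_0 \<Rightarrow> 'v::ab_group_add \<Rightarrow> 'v" and gr +
  fixes es :: "'v list" and d :: "int list"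
  assumes basis: "distinct es" "independent (set es)" "span (set es) = UNIV"
    and length_degrees: "length d = length es"
    and degrees: "\<alpha> < length es \<Longrightarrow> es ! \<alpha> \<in> shift gr 1 (- (d ! \<alpha>))"


section \<open>Functions on the formal manifold: graded commutative power series\<close>

text \<open>
  A multi-exponent \<open>m\<close> stands for the monomial \<open>(x\<^sup>0)\<^bsup>m 0\<^esup> (x\<^sup>1)\<^bsup>m 1\<^esup> \<dots>\<close>, with the factors in
  this order. Squares of odd coordinates vanish. A power series is the family of its
  coefficients, required to be zero off the admissible exponents.
\<close>

type_synonym 'k series = "(nat \<Rightarrow> nat) \<Rightarrow> 'k"

definition admissible :: "int list \<Rightarrow> (nat \<Rightarrow> nat) \<Rightarrow> bool" where
  "admissible d m \<longleftrightarrow>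
     (\<forall>\<alpha>. \<alpha> \<ge> length d \<longrightarrow> m \<alpha> = 0) \<and> (\<forall>\<alpha><length d. odd (d ! \<alpha>) \<longrightarrow> m \<alpha> \<le> 1)"

definition monom_degree :: "int list \<Rightarrow> (nat \<Rightarrow> nat) \<Rightarrow> int" where
  "monom_degree d m = (\<Sum>\<alpha><length d. int (m \<alpha>) * d ! \<alpha>)"

definition formal_functions :: "int list \<Rightarrow> 'k::field_char_0 series set" where
  "formal_functions d = {a. \<forall>m. a m \<noteq> 0 \<longrightarrow> admissible d m}"

definition formal_functions_deg :: "int list \<Rightarrow> int \<Rightarrow> 'k::field_char_0 series set" where
  "formal_functions_deg d n = {a \<in> formal_functions d. \<forall>m. a m \<noteq> 0 \<longrightarrow> monom_degree d m = n}"

definition ideal_of_zero :: "int list \<Rightarrow> 'k::field_char_0 series set" where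
  "ideal_of_zero d = {a \<in> formal_functions d. a (\<lambda>_. 0) = 0}"

definition ksign :: "int \<Rightarrow> 'k::field_char_0" where
  "ksign n = (if even n then 1 else - 1)"

definition smult :: "'k::field_char_0 \<Rightarrow> 'k series \<Rightarrow> 'k series" where
  "smult c a = (\<lambda>m. c * a m)"

text \<open>
  Bringing \<open>x\<^sup>m x\<^sup>n\<close> into normal order moves the factors \<open>x\<^sup>\<alpha>\<close> of \<open>x\<^sup>n\<close> to the left past the
  factors \<open>x\<^sup>\<beta>\<close> of \<open>x\<^sup>m\<close> with \<open>\<alpha> < \<beta>\<close>.
\<close>

definition reorder_sign :: "int list \<Rightarrow> (nat \<Rightarrow> nat) \<Rightarrow> (nat \<Rightarrow> nat) \<Rightarrow> 'k::field_char_0" where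
  "reorder_sign d m n =
     ksign (\<Sum>\<beta><length d. \<Sum>\<alpha><\<beta>. (int (m \<beta>) * d ! \<beta>) * (int (n \<alpha>) * d ! \<alpha>))"

definition fmult :: "int list \<Rightarrow> 'k::field_char_0 series \<Rightarrow> 'k series \<Rightarrow> 'k series" where
  "fmult d a b = (\<lambda>p. if admissible d p
     then \<Sum>m | m \<le> p. reorder_sign d m (p - m) * a m * b (p - m) else 0)"

definition coord :: "nat \<Rightarrow> 'k::field_char_0 series" where
  "coord \<alpha> = (\<lambda>m. if m = (\<lambda>_. 0)(\<alpha> := 1) then 1 else 0)"

text \<open>
  The left derivative: \<open>\<partial>\<^sub>\<alpha>\<close> is the derivation of degree \<open>- d ! \<alpha>\<close> with
  \<open>\<partial>\<^sub>\<alpha> x\<^sup>\<beta> = \<delta>\<^sub>\<alpha>\<^sub>\<beta>\<close>. The sign comes from passing the factors \<open>x\<^sup>\<beta>\<close> with \<open>\<beta> < \<alpha>\<close>.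
\<close>

definition partial :: "int list \<Rightarrow> nat \<Rightarrow> 'k::field_char_0 series \<Rightarrow> 'k series" where
  "partial d \<alpha> a = (\<lambda>n. ksign (d ! \<alpha> * (\<Sum>\<beta><\<alpha>. int (n \<beta>) * d ! \<beta>))
     * of_nat (Suc (n \<alpha>)) * a (n(\<alpha> := Suc (n \<alpha>))))"


section \<open>Vector fields and divergence\<close>

text \<open>
  Derivations homogeneous of degree \<open>p\<close>. A derivation is an operator on \<open>formal_functions d\<close>; the
  convention that it is zero off this set makes equality of derivations equality of operators.
\<close>

definition derivations :: "int list \<Rightarrow> int \<Rightarrow> ('k::field_char_0 series \<Rightarrow> 'k series) set" where
  "derivations d p = {V.
     (\<forall>a. a \<notin> formal_functions d \<longrightarrow> V a = 0) \<and>
     (\<forall>a\<in>formal_functions d. V a \<in> formal_functions d) \<and>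
     (\<forall>a\<in>formal_functions d. \<forall>b\<in>formal_functions d. V (a + b) = V a + V b) \<and>
     (\<forall>c. \<forall>a\<in>formal_functions d. V (smult c a) = smult c (V a)) \<and>
     (\<forall>n. \<forall>a\<in>formal_functions_deg d n. V a \<in> formal_functions_deg d (n + p)) \<and>
     (\<forall>n. \<forall>a\<in>formal_functions_deg d n. \<forall>b\<in>formal_functions d.
        V (fmult d a b) = fmult d (V a) b + smult (ksign (n * p)) (fmult d a (V b)))}"

definition vector_fields :: "int list \<Rightarrow> ('k::field_char_0 series \<Rightarrow> 'k series) set" where
  "vector_fields d = {V. \<exists>P W. finite P \<and> (\<forall>p\<in>P. W p \<in> derivations d p) \<and> V = (\<Sum>p\<in>P. W p)}"

text \<open>The tangent vector \<open>V|\<^sub>0\<close> is the functional sending \<open>a\<close> to the value of \<open>V a\<close> at \<open>0\<close>.\<close>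

definition vanishes_at_zero :: "int list \<Rightarrow> ('k::field_char_0 series \<Rightarrow> 'k series) \<Rightarrow> bool" where
  "vanishes_at_zero d V \<longleftrightarrow> (\<forall>a\<in>formal_functions d. V a (\<lambda>_. 0) = 0)"

definition commutator :: "int \<Rightarrow> int \<Rightarrow> ('k::field_char_0 series \<Rightarrow> 'k series) \<Rightarrow>
    ('k series \<Rightarrow> 'k series) \<Rightarrow> 'k series \<Rightarrow> 'k series" where
  "commutator p q V W = (\<lambda>a. V (W a) - smult (ksign (p * q)) (W (V a)))"

text \<open>
  For \<open>V\<close> of degree \<open>p\<close>, the component of \<open>V\<close> along \<open>\<partial>\<^sub>\<alpha>\<close> is \<open>V x\<^sup>\<alpha>\<close>, of degree \<open>p + d ! \<alpha>\<close>.
\<close>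

definition divergence ::
    "int list \<Rightarrow> int \<Rightarrow> ('k::field_char_0 series \<Rightarrow> 'k series) \<Rightarrow> 'k series" where
  "divergence d p V =
     (\<Sum>\<alpha><length d. smult (ksign (d ! \<alpha> * (p + d ! \<alpha>))) (partial d \<alpha> (V (coord \<alpha>))))"

definition divergence_wrt :: "int list \<Rightarrow> 'k::field_char_0 series \<Rightarrow> int \<Rightarrow>
    ('k series \<Rightarrow> 'k series) \<Rightarrow> 'k series" where
  "divergence_wrt d f p V = divergence d p V + V f"


section \<open>Unimodular L-infinity algebras\<close>

text \<open>
  A curved structure is one for which nothing is required at the point \<open>0\<close>: neither
  \<open>Q|\<^sub>0 = 0\<close>, nor that \<open>f\<close> lies in the ideal of \<open>0\<close>.
\<close>

definition curved_unimodular_Linfty :: "int list \<Rightarrow> ('k::field_char_0 series \<Rightarrow> 'k series) \<Rightarrow>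
    'k series \<Rightarrow> bool" where
  "curved_unimodular_Linfty d Q f \<longleftrightarrow>
     Q \<in> derivations d 1 \<and> Q \<circ> Q = 0 \<and> f \<in> formal_functions_deg d 0 \<and> divergence_wrt d f 1 Q = 0"

definition unimodular_Linfty :: "int list \<Rightarrow> ('k::field_char_0 series \<Rightarrow> 'k series) \<Rightarrow>
    'k series \<Rightarrow> bool" where
  "unimodular_Linfty d Q f \<longleftrightarrow>
     curved_unimodular_Linfty d Q f \<and> vanishes_at_zero d Q \<and> f \<in> ideal_of_zero d"


section \<open>The deformation complex\<close>

text \<open>
  The pair \<open>(V, g)\<close> stands for \<open>V + s g\<close>; since \<open>s\<close> has degree 1, it is homogeneous of
  degree \<open>n\<close> if \<open>V\<close> has degree \<open>n\<close> and \<open>g\<close> has degree \<open>n - 1\<close>. Differential and bracket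
  are given on homogeneous elements, whose degrees are arguments.
\<close>

type_synonym 'k cochain = "('k series \<Rightarrow> 'k series) \<times> 'k series"

definition def_complex :: "int list \<Rightarrow> int \<Rightarrow> 'k::field_char_0 cochain set" where
  "def_complex d n = derivations d n \<times> formal_functions_deg d (n - 1)"

definition def_diff :: "int list \<Rightarrow> ('k::field_char_0 series \<Rightarrow> 'k series) \<Rightarrow> 'k series \<Rightarrow>
    int \<Rightarrow> 'k cochain \<Rightarrow> 'k cochain" where
  "def_diff d Q f n = (\<lambda>(V, g). (commutator 1 n Q V, - Q g + divergence_wrt d f n V))"

text \<open>
  The term in \<open>W g\<close> is \<open>[s g, W] = - (-1)\<^bsup>p q\<^esup> [W, s g]\<close>, where \<open>[W, s g] = (-1)\<^sup>q s W(g)\<close>.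
\<close>

definition def_bracket :: "int \<Rightarrow> int \<Rightarrow> 'k::field_char_0 cochain \<Rightarrow> 'k cochain \<Rightarrow> 'k cochain" where
  "def_bracket p q = (\<lambda>(V, g) (W, h). (commutator p q V W,
     smult (ksign p) (V h) - smult (ksign (p * q) * ksign q) (W g)))"

definition cochain_scale :: "'k::field_char_0 \<Rightarrow> 'k cochain \<Rightarrow> 'k cochain" where
  "cochain_scale c = (\<lambda>(V, g). (\<lambda>a. smult c (V a), smult c g))"

definition maurer_cartan :: "int list \<Rightarrow> ('k::field_char_0 series \<Rightarrow> 'k series) \<Rightarrow> 'k series \<Rightarrow>
    'k cochain set" where
  "maurer_cartan d Q f = {m \<in> def_complex d 1.
     def_diff d Q f 1 m + cochain_scale (1/2) (def_bracket 1 1 m m) = 0}"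

end

theory Submission
  imports Defs
begin

text \<open>
  The structure equations say that \<open>F(Q, f) = (Q \<circ> Q, div Q + Q f)\<close> vanishes, and \<open>F\<close> is a
  polynomial map of degree two. Its expansion at \<open>(Q, f)\<close> therefore stops at second order, and
  the Maurer-Cartan equation collects the linear and the quadratic term:
  \<open>(Q + V)\<^sup>2 = Q\<^sup>2 + [Q,V] + \<onehalf>[V,V]\<close> for \<open>V\<close> of degree 1 (lemma \<open>square_perturbed\<close>), and
  \<open>div\<^bsub>f+g\<^esub> (Q + V) = div\<^bsub>f\<^esub> Q + (div\<^bsub>f\<^esub> V + Q g) + V g\<close>
  (lemma \<open>divergence_wrt_perturbed\<close>). The terms of order zero vanish because \<open>(Q, f)\<close> itself is
  unimodular. The differential of \<open>s g\<close> is \<open>- s Q(g)\<close> and, for \<open>V\<close> of degree 1, the bracket of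
  \<open>V\<close> with \<open>s g\<close> is \<open>- s V(g)\<close>, so that the pair \<open>(V, g)\<close> has to be matched with the element
  \<open>V - s g\<close>.

  Derivations of degree 1 form an additive group. Hence \<open>V\<close>, a priori an inhomogeneous vector
  field, is forced to have degree 1 as the difference of \<open>Q + V\<close> and \<open>Q\<close>; likewise \<open>g\<close> has
  degree 0. The conditions at the point \<open>0\<close> are linear too, so they hold for \<open>(Q + V, f + g)\<close>
  exactly when they hold for \<open>(V, g)\<close>; this yields the pointed version from the curved one.
\<close>


section \<open>Linear structure on functions and derivations\<close>

lemma smult_add_right: "smult c (a + b) = smult c a + smult c b"
  by (auto simp: smult_def fun_eq_iff algebra_simps)

lemma smult_minus_right: "smult c (- a) = - smult c a"
  by (auto simp: smult_def fun_eq_iff)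

lemma smult_minus_one: "smult (- 1) a = - a"
  by (auto simp: smult_def fun_eq_iff)

lemma fmult_add_left: "fmult d (a + b) c = fmult d a c + fmult d b c"
  by (auto simp: fmult_def fun_eq_iff algebra_simps sum.distrib)

lemma fmult_add_right: "fmult d a (b + c) = fmult d a b + fmult d a c"
  by (auto simp: fmult_def fun_eq_iff algebra_simps sum.distrib)

lemma fmult_minus_left: "fmult d (- a) b = - fmult d a b"
  by (auto simp: fmult_def fun_eq_iff sum_negf)

lemma fmult_minus_right: "fmult d a (- b) = - fmult d a b"
  by (auto simp: fmult_def fun_eq_iff sum_negf)

lemma zero_in_formal_functions: "0 \<in> formal_functions d"
  by (auto simp: formal_functions_def)

lemma formal_functions_add:
  "a \<in> formal_functions d \<Longrightarrow> b \<in> formal_functions d \<Longrightarrow> a + b \<in> formal_functions d"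
  unfolding formal_functions_def by clarsimp (metis add.right_neutral)

lemma formal_functions_minus: "a \<in> formal_functions d \<Longrightarrow> - a \<in> formal_functions d"
  by (auto simp: formal_functions_def)

lemma formal_functions_deg_add:
  "a \<in> formal_functions_deg d n \<Longrightarrow> b \<in> formal_functions_deg d n \<Longrightarrow>
   a + b \<in> formal_functions_deg d n"
  unfolding formal_functions_deg_def formal_functions_def by clarsimp (metis add.right_neutral)

lemma formal_functions_deg_minus:
  "a \<in> formal_functions_deg d n \<Longrightarrow> - a \<in> formal_functions_deg d n"
  by (auto simp: formal_functions_deg_def formal_functions_def)

lemma formal_functions_deg_subset: "formal_functions_deg d n \<subseteq> formal_functions d"
  by (auto simp: formal_functions_deg_def)

lemma derivation_closed:
  "V \<in> derivations d p \<Longrightarrow> a \<in> formal_functions d \<Longrightarrow> V a \<in> formal_functions d"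
  by (auto simp: derivations_def)

lemma derivation_outside: "V \<in> derivations d p \<Longrightarrow> a \<notin> formal_functions d \<Longrightarrow> V a = 0"
  by (auto simp: derivations_def)

lemma derivation_add:
  "V \<in> derivations d p \<Longrightarrow> a \<in> formal_functions d \<Longrightarrow> b \<in> formal_functions d \<Longrightarrow>
   V (a + b) = V a + V b"
  by (auto simp: derivations_def)

lemma derivation_minus:
  assumes "V \<in> derivations d p" "a \<in> formal_functions d"
  shows "V (- a) = - V a"
proof -
  have "V (smult (- 1) a) = smult (- 1) (V a)"
    using assms by (auto simp: derivations_def)
  then show ?thesis by (simp add: smult_minus_one)
qed

lemma derivation_zero: "V \<in> derivations d p \<Longrightarrow> V 0 = 0"
  using derivation_add[OF _ zero_in_formal_functions zero_in_formal_functions] by force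

lemma derivations_add:
  assumes "V \<in> derivations d p" "W \<in> derivations d p"
  shows "V + W \<in> derivations d p"
  using assms
  by (simp add: derivations_def formal_functions_add formal_functions_deg_add
      subsetD[OF formal_functions_deg_subset] smult_add_right fmult_add_left fmult_add_right
      algebra_simps)

lemma derivations_minus:
  assumes "V \<in> derivations d p"
  shows "- V \<in> derivations d p"
  using assms
  by (simp add: derivations_def formal_functions_minus formal_functions_deg_minus
      subsetD[OF formal_functions_deg_subset] smult_minus_right fmult_minus_left fmult_minus_right)

text \<open>
  Membership of a perturbation in a subgroup is membership of the perturbing term. It serves for
  the degree conditions and for the ideal of \<open>0\<close>.
\<close>

lemma add_cancel_left_mem:
  fixes x y :: "'a::ab_group_add"
  assumes add: "\<And>u v. u \<in> S \<Longrightarrow> v \<in> S \<Longrightarrow> u + v \<in> S" and minus: "\<And>u. u \<in> S \<Longrightarrow> - u \<in> S"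
    and x: "x \<in> S"
  shows "x + y \<in> S \<longleftrightarrow> y \<in> S"
  using add[OF _ minus[OF x], of "x + y"] add[OF x, of y] by auto

lemma derivations_add_cancel:
  "Q \<in> derivations d p \<Longrightarrow> Q + V \<in> derivations d p \<longleftrightarrow> V \<in> derivations d p"
  by (rule add_cancel_left_mem) (auto intro: derivations_add derivations_minus)

lemma formal_functions_deg_add_cancel:
  "f \<in> formal_functions_deg d n \<Longrightarrow>
   f + g \<in> formal_functions_deg d n \<longleftrightarrow> g \<in> formal_functions_deg d n"
  by (rule add_cancel_left_mem) (auto intro: formal_functions_deg_add formal_functions_deg_minus)

lemma minus_in_formal_functions_deg_iff:
  "- a \<in> formal_functions_deg d n \<longleftrightarrow> a \<in> formal_functions_deg d n"
  using formal_functions_deg_minus[of a d n] formal_functions_deg_minus[of "- a" d n] by auto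

lemma derivations_subset_vector_fields: "derivations d p \<subseteq> vector_fields d"
proof
  fix V :: "'a series \<Rightarrow> 'a series"
  assume "V \<in> derivations d p"
  then show "V \<in> vector_fields d"
    unfolding vector_fields_def by (intro CollectI exI[of _ "{p}"] exI[of _ "\<lambda>_. V"]) simp
qed

lemma partial_add: "partial d \<alpha> (a + b) = partial d \<alpha> a + partial d \<alpha> b"
  by (auto simp: partial_def fun_eq_iff algebra_simps)

lemma divergence_add: "divergence d p (V + W) = divergence d p V + divergence d p W"
  by (simp add: divergence_def partial_add smult_add_right sum.distrib)


section \<open>Expansion of the structure equations\<close>

text \<open>
  For odd operators the commutator is the anticommutator: \<open>[Q,V]\<close> consists of the mixed terms of
  the square, and \<open>[V,V] = 2 V \<circ> V\<close> absorbs the factor one half.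
\<close>

lemma square_perturbed:
  assumes Q: "Q \<in> derivations d 1" and V: "V \<in> derivations d 1"
  shows "(Q + V) \<circ> (Q + V) =
    (Q \<circ> Q) + (commutator 1 1 Q V + (\<lambda>a. smult (1/2) (commutator 1 1 V V a)))"
proof
  fix a
  have mixed: "commutator 1 1 Q V a = Q (V a) + V (Q a)"
    by (simp add: commutator_def ksign_def smult_minus_one)
  have self: "smult (1/2) (commutator 1 1 V V a) = V (V a)"
    by (auto simp: commutator_def ksign_def smult_def fun_eq_iff)
  show "((Q + V) \<circ> (Q + V)) a =
    ((Q \<circ> Q) + (commutator 1 1 Q V + (\<lambda>a. smult (1/2) (commutator 1 1 V V a)))) a"
  proof (cases "a \<in> formal_functions d")
    case True
    then show ?thesis
      using derivation_add[OF Q] derivation_add[OF V] derivation_closed[OF Q] derivation_closed[OF V]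
      by (simp add: mixed self)
  next
    case False
    then show ?thesis
      using derivation_outside[OF Q False] derivation_outside[OF V False]
        derivation_zero[OF Q] derivation_zero[OF V]
      by (simp add: mixed self)
  qed
qed

lemma divergence_wrt_perturbed:
  assumes Q: "Q \<in> derivations d p" and V: "V \<in> derivations d p"
    and "f \<in> formal_functions d" "g \<in> formal_functions d"
  shows "divergence_wrt d (f + g) p (Q + V) =
    divergence_wrt d f p Q + ((divergence_wrt d f p V + Q g) + V g)"
  using assms
  by (simp add: divergence_wrt_def divergence_add derivation_add[OF Q] derivation_add[OF V]
      algebra_simps)

text \<open>
  In \<open>[V - s g, V - s g]\<close> the two mixed terms agree, each being \<open>s V(g)\<close>, since \<open>V\<close> and \<open>s g\<close>
  both have degree 1.
\<close>

lemma half_bracket_self: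
  assumes V: "V \<in> derivations d 1" and g: "g \<in> formal_functions d"
  shows "cochain_scale (1/2) (def_bracket 1 1 (V, - g) (V, - g)) =
    (\<lambda>a. smult (1/2) (commutator 1 1 V V a), V g)"
  by (simp add: cochain_scale_def def_bracket_def derivation_minus[OF V g] ksign_def
      smult_minus_one) (auto simp: smult_def fun_eq_iff)

lemma curved_unimodular_perturbation_iff_maurer_cartan:
  assumes "curved_unimodular_Linfty d Q f"
  shows "curved_unimodular_Linfty d (Q + V) (f + g) \<longleftrightarrow> (V, - g) \<in> maurer_cartan d Q f"
proof -
  have Q: "Q \<in> derivations d 1" "Q \<circ> Q = 0" and f: "f \<in> formal_functions_deg d 0"
    and div: "divergence_wrt d f 1 Q = 0"
    using assms by (auto simp: curved_unimodular_Linfty_def)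
  show ?thesis
  proof (cases "V \<in> derivations d 1 \<and> g \<in> formal_functions_deg d 0")
    case True
    then have V: "V \<in> derivations d 1" and g: "g \<in> formal_functions d"
      using formal_functions_deg_subset by auto
    have "curved_unimodular_Linfty d (Q + V) (f + g) \<longleftrightarrow>
        commutator 1 1 Q V + (\<lambda>a. smult (1/2) (commutator 1 1 V V a)) = 0 \<and>
        (divergence_wrt d f 1 V + Q g) + V g = 0"
      using True f
      by (simp add: curved_unimodular_Linfty_def derivations_add_cancel[OF Q(1)]
          formal_functions_deg_add_cancel[OF f] square_perturbed[OF Q(1) V] Q(2) div
          divergence_wrt_perturbed[OF Q(1) V _ g] subsetD[OF formal_functions_deg_subset f])
    also have "\<dots> \<longleftrightarrow> (V, - g) \<in> maurer_cartan d Q f"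
      using True
      by (simp add: maurer_cartan_def def_complex_def minus_in_formal_functions_deg_iff
          half_bracket_self[OF V g] def_diff_def derivation_minus[OF Q(1) g] zero_prod_def)
    finally show ?thesis .
  next
    \<comment> \<open>Outside these degrees both sides fail, the left one because the components of
      \<open>(Q, f)\<close> can be subtracted.\<close>
    case False
    then show ?thesis
      by (auto simp: curved_unimodular_Linfty_def derivations_add_cancel[OF Q(1)]
          formal_functions_deg_add_cancel[OF f] maurer_cartan_def def_complex_def
          minus_in_formal_functions_deg_iff)
  qed
qed

lemma unimodular_perturbation_iff_maurer_cartan:
  assumes "unimodular_Linfty d Q f"
  shows "unimodular_Linfty d (Q + V) (f + g) \<longleftrightarrow>
    (V, - g) \<in> maurer_cartan d Q f \<and> vanishes_at_zero d V \<and> - g \<in> ideal_of_zero d"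
proof -
  have curved: "curved_unimodular_Linfty d Q f" and Q: "vanishes_at_zero d Q"
    and f: "f \<in> ideal_of_zero d"
    using assms by (auto simp: unimodular_Linfty_def)
  have "vanishes_at_zero d (Q + V) \<longleftrightarrow> vanishes_at_zero d V"
    using Q by (simp add: vanishes_at_zero_def)
  moreover have "f + g \<in> ideal_of_zero d \<longleftrightarrow> g \<in> ideal_of_zero d"
    using f by (intro add_cancel_left_mem)
      (auto simp: ideal_of_zero_def formal_functions_add formal_functions_minus)
  moreover have "- g \<in> ideal_of_zero d \<longleftrightarrow> g \<in> ideal_of_zero d"
    using formal_functions_minus[of g d] formal_functions_minus[of "- g" d]
    by (auto simp: ideal_of_zero_def)
  ultimately show ?thesis
    by (simp add: unimodular_Linfty_def curved_unimodular_perturbation_iff_maurer_cartan[OF curved])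
qed


section \<open>The correspondence\<close>

lemma maurer_cartan_components:
  assumes "(V, - g) \<in> maurer_cartan d Q f"
  shows "V \<in> vector_fields d" "g \<in> formal_functions d"
  using assms
  by (auto simp: maurer_cartan_def def_complex_def minus_in_formal_functions_deg_iff
      dest: subsetD[OF derivations_subset_vector_fields] subsetD[OF formal_functions_deg_subset])

lemma bij_betw_negate_snd:
  fixes A B :: "('a \<times> 'b::group_add) set"
  assumes "\<And>x y. (x, y) \<in> A \<longleftrightarrow> (x, - y) \<in> B"
  shows "bij_betw (\<lambda>(x, y). (x, - y)) A B"
  by (rule bij_betw_byWitness[where f' = "\<lambda>(x, y). (x, - y)"]) (auto simp: assms)

theorem theorem3:
  fixes scale :: "'k::field_char_0 \<Rightarrow> 'v::ab_group_add \<Rightarrow> 'v"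
    and gr :: "int \<Rightarrow> 'v set" and es :: "'v list" and d :: "int list"
    and Q :: "'k series \<Rightarrow> 'k series" and f :: "'k series"
  assumes "homogeneous_coordinates scale gr es d"
    and "unimodular_Linfty d Q f"
  shows "bij_betw (\<lambda>(V, g). (V, - g))
           {(V, g). V \<in> vector_fields d \<and> g \<in> formal_functions d \<and> unimodular_Linfty d (Q + V) (f + g)}
           {(V, g) \<in> maurer_cartan d Q f. vanishes_at_zero d V \<and> g \<in> ideal_of_zero d}
       \<and> bij_betw (\<lambda>(V, g). (V, - g))
           {(V, g). V \<in> vector_fields d \<and> g \<in> formal_functions d \<and> curved_unimodular_Linfty d (Q + V) (f + g)}
           (maurer_cartan d Q f)"
proof (intro conjI bij_betw_negate_snd)
  have curved: "curved_unimodular_Linfty d Q f"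
    using assms(2) by (simp add: unimodular_Linfty_def)
  fix V :: "'k series \<Rightarrow> 'k series" and g :: "'k series"
  show "(V, g) \<in> {(V, g). V \<in> vector_fields d \<and> g \<in> formal_functions d \<and>
          unimodular_Linfty d (Q + V) (f + g)} \<longleftrightarrow>
        (V, - g) \<in> {(V, g) \<in> maurer_cartan d Q f. vanishes_at_zero d V \<and> g \<in> ideal_of_zero d}"
    using unimodular_perturbation_iff_maurer_cartan[OF assms(2), of V g]
      maurer_cartan_components[of V g d Q f] by auto
  show "(V, g) \<in> {(V, g). V \<in> vector_fields d \<and> g \<in> formal_functions d \<and>
          curved_unimodular_Linfty d (Q + V) (f + g)} \<longleftrightarrow> (V, - g) \<in> maurer_cartan d Q f"
    using curved_unimodular_perturbation_iff_maurer_cartan[OF curved, of V g]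
      maurer_cartan_components[of V g d Q f] by auto
qed

end
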